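(* For $j=1,\ldots,n$ let $a_j:\mathbb D^n\to(0,\infty)$ be functions, and put $$\mathcal N(p;v)=\max_{1\le j\le n}a_j(p)|v_j|,\qquad p\in\mathbb D^n,\ v\in\mathbb C^n.$$ Assume that every harmonic map $F:\mathbb D\to\mathbb D^n$ satisfies $$\mathcal N(F(z);dF_z\xi)\le\frac{2|\xi|}{1-|z|^2}$$ for all $z\in\mathbb D$ and all tangent vectors $\xi\in T_z\mathbb D$. Then $\mathcal N(p;v)\le\mathcal H_{\mathbb D^n}(p;v)$ for every $p\in\mathbb D^n$ and $v\in\mathbb C^n$.
   Context: $\mathbb D=\{z\in\mathbb C:|z|<1\}$; harmonic maps into $\mathbb C^n$ are understood componentwise and $dF_z$ is the real differential. The function $\mathcal M:[0,1)\to(0,\infty)$ is given by $\mathcal M(0)=4/\pi$ and, for $0<r<1$, $$\mathcal M(r)=2\int_0^{2\pi}\frac{\cos^2t}{\sqrt{\lambda(r)^2+\cos^2t}}\,\frac{dt}{2\pi},$$ where $\lambda(r)>0$ is the unique positive solution of $$r=\int_0^{2\pi}\frac{\lambda(r)}{\sqrt{\lambda(r)^2+\cos^2t}}\,\frac{dt}{2\pi}.$$ For $p\in\mathbb D^n$ and $v\in\mathbb C^n$, $$\mathcal H_{\mathbb D^n}(p;v)=\max_{1\le j\le n}\frac{2|v_j|}{\mathcal M(|p_j|)}.$$ *)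

theory Defs
  imports "HOL-Analysis.Analysis"
begin

abbreviation unit_disc :: "complex set" where
  "unit_disc \<equiv> ball 0 1"

definition polydisc :: "(complex ^ 'n) set" where
  "polydisc = {p. \<forall>j. p $ j \<in> unit_disc}"

text \<open>\<open>u\<close> is of class \<open>C\<^sup>2\<close> (as a function of two real variables) with vanishing Laplacian;
  \<open>u'\<close> and \<open>u''\<close> are its first and second real Frechet derivatives. Meant for open \<open>S\<close>.\<close>

definition harmonic_on :: "(complex \<Rightarrow> complex) \<Rightarrow> complex set \<Rightarrow> bool" where
  "harmonic_on u S \<longleftrightarrow>
     (\<exists>(u' :: complex \<Rightarrow> complex \<Rightarrow>\<^sub>L complex)
        (u'' :: complex \<Rightarrow> complex \<Rightarrow>\<^sub>L (complex \<Rightarrow>\<^sub>L complex)).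
        (\<forall>z\<in>S. (u has_derivative blinfun_apply (u' z)) (at z)) \<and>
        (\<forall>z\<in>S. (u' has_derivative blinfun_apply (u'' z)) (at z)) \<and>
        continuous_on S u'' \<and>
        (\<forall>z\<in>S. blinfun_apply (blinfun_apply (u'' z) 1) 1
              + blinfun_apply (blinfun_apply (u'' z) \<i>) \<i> = 0))"

definition harmonic_map_on :: "(complex \<Rightarrow> complex ^ 'n) \<Rightarrow> complex set \<Rightarrow> bool" where
  "harmonic_map_on F S \<longleftrightarrow> (\<forall>j. harmonic_on (\<lambda>z. F z $ j) S)"

text \<open>Only the values for \<open>0 < r < 1\<close> are meaningful; there the solution exists and is unique.\<close>

definition lambda_fun :: "real \<Rightarrow> real" where
  "lambda_fun r = (THE l. 0 < l \<and>
     r = integral {0..2*pi} (\<lambda>t. l / sqrt (l\<^sup>2 + (cos t)\<^sup>2) / (2*pi)))"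

definition M_fun :: "real \<Rightarrow> real" where
  "M_fun r = (if r = 0 then 4 / pi
     else 2 * integral {0..2*pi}
       (\<lambda>t. (cos t)\<^sup>2 / sqrt ((lambda_fun r)\<^sup>2 + (cos t)\<^sup>2) / (2*pi)))"

definition H_polydisc :: "complex ^ 'n \<Rightarrow> complex ^ 'n \<Rightarrow> real" where
  "H_polydisc p v = (MAX j\<in>UNIV. 2 * cmod (v $ j) / M_fun (cmod (p $ j)))"

definition weighted_max ::
    "('n \<Rightarrow> complex ^ 'n \<Rightarrow> real) \<Rightarrow> complex ^ 'n \<Rightarrow> complex ^ 'n \<Rightarrow> real" where
  "weighted_max a p v = (MAX j\<in>UNIV. a j p * cmod (v $ j))"

end

theory Submission
  imports Defs "HOL-Complex_Analysis.Cauchy_Integral_Formula"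
begin

text \<open>Take \<open>r = |p\<^sub>j|\<close> and \<open>l = \<lambda>(r)\<close>. The Poisson integral \<open>f\<close> of
  \<open>\<phi>(t) = (l + \<i> cos t) / sqrt (l\<^sup>2 + cos\<^sup>2 t)\<close> maps the disc to itself, since \<open>|\<phi>| = 1\<close> and
  \<open>\<phi>\<close> is not constant. Its value at \<open>0\<close> is the mean of \<open>\<phi>\<close>, which is \<open>r\<close>, and its derivative
  at \<open>0\<close> in direction \<open>1\<close> is twice the mean of \<open>\<phi> cos\<close>, which is \<open>\<i> M(r)\<close>. Applying the hypothesis
  at \<open>z = 0\<close> to the map with \<open>j\<close>-th component a rotation of \<open>f\<close> and all other components constant gives
  \<open>a\<^sub>j(p) M(r) \<le> 2\<close>.\<close>

section \<open>Harmonic functions: the holomorphic case and closure properties\<close>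

text \<open>The real derivative at \<open>z\<close> is multiplication by \<open>deriv f z\<close>.
  The second derivative sends \<open>v\<close>, \<open>w\<close> to f''(z) v w, so the Laplacian is
  f''(z) (1 + \<i>^2) = 0. \<open>R\<close> is the linear map from a number to its multiplication
  operator.\<close>

lemma harmonic_on_holomorphic:
  assumes "open S" "f holomorphic_on S"
  shows "harmonic_on f S"
proof -
  define R :: "complex \<Rightarrow>\<^sub>L complex \<Rightarrow>\<^sub>L complex" where "R = Blinfun blinfun_mult_right"
  have R: "blinfun_apply R c = blinfun_mult_right c" for c
    unfolding R_def by (simp add: bounded_linear_Blinfun_apply bounded_linear_blinfun_mult_right)
  have hol': "deriv f holomorphic_on S" and hol'': "deriv (deriv f) holomorphic_on S"
    using assms by (auto intro: holomorphic_deriv)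
  have "(f has_derivative blinfun_apply (blinfun_mult_right (deriv f z))) (at z)" if "z \<in> S" for z
    using holomorphic_derivI[OF assms(2,1) that] by (simp add: has_field_derivative_def)
  moreover have "((\<lambda>z. blinfun_mult_right (deriv f z)) has_derivative
      blinfun_apply (R o\<^sub>L blinfun_mult_right (deriv (deriv f) z))) (at z)" if "z \<in> S" for z
  proof -
    have "(deriv f has_derivative (*) (deriv (deriv f) z)) (at z)"
      using holomorphic_derivI[OF hol' assms(1) that] by (simp add: has_field_derivative_def)
    from bounded_linear.has_derivative[OF bounded_linear_blinfun_mult_right this]
    show ?thesis by (rule has_derivative_eq_rhs) (simp add: R fun_eq_iff)
  qed
  moreover have "continuous_on S (\<lambda>z. R o\<^sub>L blinfun_mult_right (deriv (deriv f) z))"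
    using holomorphic_on_imp_continuous_on[OF hol''] by (intro continuous_intros)
  ultimately show ?thesis
    unfolding harmonic_on_def
    by (intro exI[of _ "\<lambda>z. blinfun_mult_right (deriv f z)"]
        exI[of _ "\<lambda>z. R o\<^sub>L blinfun_mult_right (deriv (deriv f) z)"]) (simp add: R mult.assoc)
qed

lemma harmonic_on_add:
  assumes "harmonic_on u S" "harmonic_on w S"
  shows "harmonic_on (\<lambda>z. u z + w z) S"
proof -
  obtain u' u'' where u: "\<forall>z\<in>S. (u has_derivative blinfun_apply (u' z)) (at z)"
      "\<forall>z\<in>S. (u' has_derivative blinfun_apply (u'' z)) (at z)" "continuous_on S u''"
      "\<forall>z\<in>S. u'' z 1 1 + u'' z \<i> \<i> = 0"
    using assms(1) unfolding harmonic_on_def by auto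
  obtain w' w'' where w: "\<forall>z\<in>S. (w has_derivative blinfun_apply (w' z)) (at z)"
      "\<forall>z\<in>S. (w' has_derivative blinfun_apply (w'' z)) (at z)" "continuous_on S w''"
      "\<forall>z\<in>S. w'' z 1 1 + w'' z \<i> \<i> = 0"
    using assms(2) unfolding harmonic_on_def by auto
  have "((\<lambda>z. u z + w z) has_derivative blinfun_apply (u' z + w' z)) (at z)"
      "((\<lambda>z. u' z + w' z) has_derivative blinfun_apply (u'' z + w'' z)) (at z)" if "z \<in> S" for z
    using u w that by (auto simp: blinfun.add_left[abs_def] plus_blinfun.rep_eq[abs_def] intro!: has_derivative_add)
  moreover have "(u'' z + w'' z) 1 1 + (u'' z + w'' z) \<i> \<i> = 0" if "z \<in> S" for z
  proof -
    have "(u'' z + w'' z) 1 1 + (u'' z + w'' z) \<i> \<i>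
        = (u'' z 1 1 + u'' z \<i> \<i>) + (w'' z 1 1 + w'' z \<i> \<i>)"
      by (simp add: blinfun.bilinear_simps)
    then show ?thesis using u(4) w(4) that by simp
  qed
  moreover have "continuous_on S (\<lambda>z. u'' z + w'' z)"
    using u(3) w(3) by (intro continuous_intros)
  ultimately show ?thesis
    unfolding harmonic_on_def
    by (intro exI[of _ "\<lambda>z. u' z + w' z"] exI[of _ "\<lambda>z. u'' z + w'' z"]) blast
qed

text \<open>A fixed real-linear map commutes with differentiation, hence with the Laplacian. It is
  applied to conjugation, which turns holomorphic functions into antiholomorphic ones, and to
  multiplication by a unimodular constant.\<close>

lemma harmonic_on_bounded_linear:
  assumes "bounded_linear l" "harmonic_on u S"
  shows "harmonic_on (\<lambda>z. l (u z)) S"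
proof -
  obtain u' u'' where u: "\<forall>z\<in>S. (u has_derivative blinfun_apply (u' z)) (at z)"
      "\<forall>z\<in>S. (u' has_derivative blinfun_apply (u'' z)) (at z)" "continuous_on S u''"
      "\<forall>z\<in>S. u'' z 1 1 + u'' z \<i> \<i> = 0"
    using assms(2) unfolding harmonic_on_def by auto
  define L where "L = Blinfun l"
  have L: "blinfun_apply L = l" unfolding L_def
    by (simp add: assms(1) bounded_linear_Blinfun_apply)
  have bl: "bounded_linear (\<lambda>A :: complex \<Rightarrow>\<^sub>L complex. L o\<^sub>L A)"
    by (rule bounded_bilinear.bounded_linear_right[OF bounded_bilinear_blinfun_compose])
  define C where "C = Blinfun (\<lambda>A :: complex \<Rightarrow>\<^sub>L complex. L o\<^sub>L A)"
  have C: "blinfun_apply C A = L o\<^sub>L A" for A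
    unfolding C_def by (simp add: bl bounded_linear_Blinfun_apply)
  have "((\<lambda>z. l (u z)) has_derivative blinfun_apply (L o\<^sub>L u' z)) (at z)" if "z \<in> S" for z
    by (rule has_derivative_eq_rhs[OF bounded_linear.has_derivative[OF assms(1), of u "blinfun_apply (u' z)"]])
      (use u(1) that in \<open>auto simp: L\<close>)
  moreover have "((\<lambda>z. L o\<^sub>L u' z) has_derivative blinfun_apply (C o\<^sub>L u'' z)) (at z)"
    if "z \<in> S" for z
    by (rule has_derivative_eq_rhs[OF bounded_linear.has_derivative[OF bl, of u' "blinfun_apply (u'' z)"]])
      (use u(2) that in \<open>auto simp: C\<close>)
  moreover have "(C o\<^sub>L u'' z) 1 1 + (C o\<^sub>L u'' z) \<i> \<i> = 0" if "z \<in> S" for z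
    using u(4) that by (simp add: C flip: blinfun.add_right)
  moreover have "continuous_on S (\<lambda>z. C o\<^sub>L u'' z)"
    using u(3) by (intro continuous_intros)
  ultimately show ?thesis
    unfolding harmonic_on_def
    by (intro exI[of _ "\<lambda>z. L o\<^sub>L u' z"] exI[of _ "\<lambda>z. C o\<^sub>L u'' z"]) blast
qed

section \<open>The Poisson integral as a sum of Cauchy integrals\<close>

definition circle_mean :: "(real \<Rightarrow> 'a::real_normed_vector) \<Rightarrow> 'a" where
  "circle_mean \<phi> = integral {0..2*pi} \<phi> /\<^sub>R (2*pi)"

text \<open>With \<zeta> = e^(it), the kernel is \<zeta> / (\<zeta> - z) and dt / (2 pi) is d\<zeta>
  / (2 pi \<i> \<zeta>). So this is the Cauchy integral of \<open>\<phi>\<close> over the unit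
  circle.\<close>

definition cauchy_mean :: "(real \<Rightarrow> complex) \<Rightarrow> complex \<Rightarrow> complex" where
  "cauchy_mean \<phi> z = circle_mean (\<lambda>t. \<phi> t / (1 - z * cis (-t)))"

text \<open>The Poisson integral, split into a holomorphic and an antiholomorphic part. Each part
  contributes the mean of \<open>\<phi>\<close> at 0, so it is subtracted once. In this form
  harmonicity follows from the holomorphic case.\<close>

definition poisson_mean :: "(real \<Rightarrow> complex) \<Rightarrow> complex \<Rightarrow> complex" where
  "poisson_mean \<phi> z = cauchy_mean \<phi> z + cnj (cauchy_mean (\<lambda>t. cnj (\<phi> t)) z) - circle_mean \<phi>"

lemma cauchy_kernel_nz: "1 - z * cis t \<noteq> 0" if "z \<in> unit_disc"
proof
  assume "1 - z * cis t = 0"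
  then have "z * cis t = 1" by simp
  then have "cmod (z * cis t) = 1" by simp
  then have "cmod z = 1" by (simp add: norm_mult)
  with that show False by simp
qed

lemma DERIV_cauchy_mean:
  assumes \<phi>: "continuous_on {0..2*pi} \<phi>" and z: "z \<in> unit_disc"
  shows "(cauchy_mean \<phi> has_field_derivative
          circle_mean (\<lambda>t. \<phi> t * cis (-t) / (1 - z * cis (-t))\<^sup>2)) (at z)"
proof -
  have "((\<lambda>z. integral (cbox 0 (2*pi)) (\<lambda>t. \<phi> t / (1 - z * cis (-t)))) has_field_derivative
      integral (cbox 0 (2*pi)) (\<lambda>t. \<phi> t * cis (-t) / (1 - z * cis (-t))\<^sup>2)) (at z within unit_disc)"
  proof (rule leibniz_rule_field_derivative)
    show "((\<lambda>z. \<phi> t / (1 - z * cis (-t))) has_field_derivative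
        \<phi> t * cis (-t) / (1 - z * cis (-t))\<^sup>2) (at z within unit_disc)" if "z \<in> unit_disc" for z t
      using cauchy_kernel_nz[OF that, of "-t"]
      by (auto intro!: derivative_eq_intros simp: power2_eq_square)
    show "(\<lambda>t. \<phi> t / (1 - z * cis (-t))) integrable_on cbox 0 (2*pi)" if "z \<in> unit_disc" for z
      using cauchy_kernel_nz[OF that] \<phi>
      by (intro integrable_continuous continuous_intros) auto
    show "continuous_on (unit_disc \<times> cbox 0 (2*pi))
        (\<lambda>(z, t). \<phi> t * cis (-t) / (1 - z * cis (-t))\<^sup>2)"
      unfolding split_beta
      using cauchy_kernel_nz
      by (intro continuous_intros continuous_on_compose2[OF \<phi>]) auto
  qed (use z in auto)
  then have "((\<lambda>z. integral {0..2*pi} (\<lambda>t. \<phi> t / (1 - z * cis (-t)))) has_field_derivative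
      integral {0..2*pi} (\<lambda>t. \<phi> t * cis (-t) / (1 - z * cis (-t))\<^sup>2)) (at z)"
    unfolding at_within_open[OF z open_ball] cbox_interval .
  from DERIV_cmult[OF this, of "of_real (inverse (2*pi))"] show ?thesis
    unfolding cauchy_mean_def[abs_def] circle_mean_def scaleR_conv_of_real .
qed

lemma harmonic_on_poisson_mean:
  assumes \<phi>: "continuous_on {0..2*pi} \<phi>"
  shows "harmonic_on (poisson_mean \<phi>) unit_disc"
proof -
  have hol: "cauchy_mean \<psi> holomorphic_on unit_disc" if "continuous_on {0..2*pi} \<psi>" for \<psi>
    unfolding holomorphic_on_open[OF open_ball] using DERIV_cauchy_mean[OF that] by blast
  have cnj: "continuous_on {0..2*pi} (\<lambda>t. cnj (\<phi> t))"
    using \<phi> by (intro continuous_intros)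
  have "poisson_mean \<phi> =
      (\<lambda>z. cauchy_mean \<phi> z + (cnj (cauchy_mean (\<lambda>t. cnj (\<phi> t)) z) + - circle_mean \<phi>))"
    by (auto simp: poisson_mean_def)
  then show ?thesis
    by (simp only:) (intro harmonic_on_add harmonic_on_bounded_linear[OF bounded_linear_cnj]
        harmonic_on_holomorphic[OF open_ball] hol \<phi> cnj holomorphic_on_const)
qed

text \<open>In direction 1 the two Cauchy parts contribute the means of \<open>\<phi>\<close>
  against e^(-it) and e^(it), and these kernels add up to 2 cos t.\<close>

lemma has_derivative_poisson_mean_0:
  assumes \<phi>: "continuous_on {0..2*pi} \<phi>"
  obtains D where "(poisson_mean \<phi> has_derivative D) (at 0)"
    "D 1 = 2 * circle_mean (\<lambda>t. \<phi> t * of_real (cos t))"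
proof -
  have cnj: "continuous_on {0..2*pi} (\<lambda>t. cnj (\<phi> t))"
    using \<phi> by (intro continuous_intros)
  define a b where "a = circle_mean (\<lambda>t. \<phi> t * cis (-t))"
    and "b = circle_mean (\<lambda>t. cnj (\<phi> t) * cis (-t))"
  have a: "(cauchy_mean \<phi> has_derivative (*) a) (at 0)"
    using DERIV_cauchy_mean[OF \<phi>, of 0] by (simp add: a_def has_field_derivative_def)
  have b: "(cauchy_mean (\<lambda>t. cnj (\<phi> t)) has_derivative (*) b) (at 0)"
    using DERIV_cauchy_mean[OF cnj, of 0] by (simp add: b_def has_field_derivative_def)
  have "(poisson_mean \<phi> has_derivative (\<lambda>v. a * v + cnj (b * v) - 0)) (at 0)"
    unfolding poisson_mean_def[abs_def]
    by (intro derivative_intros bounded_linear.has_derivative[OF bounded_linear_cnj] a b)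
  moreover have "a * 1 + cnj (b * 1) - 0 = 2 * circle_mean (\<lambda>t. \<phi> t * of_real (cos t))"
  proof -
    have "a + cnj b = (integral {0..2*pi} (\<lambda>t. \<phi> t * cis (-t))
        + integral {0..2*pi} (\<lambda>t. \<phi> t * cis t)) /\<^sub>R (2*pi)"
      by (simp add: a_def b_def circle_mean_def scaleR_add_right cis_cnj integral_cnj)
    also have "\<dots> = integral {0..2*pi} (\<lambda>t. \<phi> t * cis (-t) + \<phi> t * cis t) /\<^sub>R (2*pi)"
      using \<phi> by (subst integral_add) (auto intro!: integrable_continuous_real continuous_intros)
    also have "(\<lambda>t. \<phi> t * cis (-t) + \<phi> t * cis t) = (\<lambda>t. 2 * (\<phi> t * of_real (cos t)))"
      by (auto simp: complex_eq_iff algebra_simps)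
    finally show ?thesis by (simp add: circle_mean_def)
  qed
  ultimately show ?thesis using that by blast
qed

lemma poisson_mean_0: "poisson_mean \<phi> 0 = circle_mean \<phi>"
  by (simp add: poisson_mean_def cauchy_mean_def circle_mean_def integral_cnj)

text \<open>This is Cauchy's integral formula for the constant 1 on the unit circle, in the angular
  parameter.\<close>

lemma cauchy_mean_1:
  assumes z: "z \<in> unit_disc"
  shows "cauchy_mean (\<lambda>_. 1) z = 1"
proof -
  have "((\<lambda>u. 1/(u-z)) has_contour_integral (2 * of_real pi * \<i> * 1)) (circlepath 0 1)"
    using z by (intro Cauchy_integral_circlepath_simple[where f = "\<lambda>_. 1"]) auto
  then have "contour_integral (part_circlepath 0 1 0 (2*pi)) (\<lambda>u. 1/(u-z)) = 2 * of_real pi * \<i>"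
    by (simp add: contour_integral_unique circlepath_def)
  then have "integral {0..2*pi} (\<lambda>t. 1/(cis t - z) * \<i> * cis t) = 2 * of_real pi * \<i>"
    by (subst (asm) contour_integral_part_circlepath_eq) auto
  also have "(\<lambda>t. 1/(cis t - z) * \<i> * cis t) = (\<lambda>t. \<i> * (1 / (1 - z * cis (-t))))"
  proof
    fix t
    have eq: "cis t - z = cis t * (1 - z * cis (-t))"
      by (simp add: right_diff_distrib mult.left_commute[of "cis t" z] cis_mult)
    have "1 / (c * w) * \<i> * c = \<i> * (1 / w)" if "c \<noteq> 0" for c w :: complex
      using that by simp
    then show "1/(cis t - z) * \<i> * cis t = \<i> * (1 / (1 - z * cis (-t)))"
      unfolding eq using cis_neq_zero[of t] by blast
  qed
  finally have "\<i> * integral {0..2*pi} (\<lambda>t. 1 / (1 - z * cis (-t))) = 2 * of_real pi * \<i>"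
    by (simp only: integral_mult_right)
  then have "integral {0..2*pi} (\<lambda>t. 1 / (1 - z * cis (-t))) = 2 * of_real pi"
    by simp
  then show ?thesis by (simp add: cauchy_mean_def circle_mean_def scaleR_conv_of_real)
qed

section \<open>The Poisson kernel: mass, Harnack bound and the disc as target\<close>

text \<open>This is the classical kernel (1 - |z|^2) / |1 - z e^(-it)|^2. The form with a real part
  is K + cnj K - 1 for the Cauchy kernel K, matching \<open>poisson_mean\<close>.\<close>

definition poisson_kernel :: "complex \<Rightarrow> real \<Rightarrow> real" where
  "poisson_kernel z t = 2 * Re (1 / (1 - z * cis (-t))) - 1"

lemma continuous_on_poisson_kernel:
  assumes "z \<in> unit_disc"
  shows "continuous_on A (poisson_kernel z)"
  unfolding poisson_kernel_def[abs_def] using cauchy_kernel_nz[OF assms]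
  by (intro continuous_intros) auto

lemma poisson_mean_eq:
  assumes \<phi>: "continuous_on {0..2*pi} \<phi>" and z: "z \<in> unit_disc"
  shows "poisson_mean \<phi> z = circle_mean (\<lambda>t. of_real (poisson_kernel z t) * \<phi> t)"
proof -
  let ?K = "\<lambda>t. 1 / (1 - z * cis (-t))"
  have K: "continuous_on {0..2*pi} ?K"
    using cauchy_kernel_nz[OF z] by (intro continuous_intros) auto
  have int: "(\<lambda>t. \<phi> t * ?K t) integrable_on {0..2*pi}"
      "(\<lambda>t. \<phi> t * cnj (?K t)) integrable_on {0..2*pi}" "\<phi> integrable_on {0..2*pi}"
    by (intro integrable_continuous_real continuous_on_mult continuous_on_cnj \<phi> K)+
  have "poisson_mean \<phi> z = (integral {0..2*pi} (\<lambda>t. \<phi> t * ?K t)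
      + integral {0..2*pi} (\<lambda>t. \<phi> t * cnj (?K t)) - integral {0..2*pi} \<phi>) /\<^sub>R (2*pi)"
    by (simp add: poisson_mean_def cauchy_mean_def circle_mean_def scaleR_add_right
        scaleR_diff_right integral_cnj)
  also have "\<dots> = circle_mean (\<lambda>t. \<phi> t * ?K t + \<phi> t * cnj (?K t) - \<phi> t)"
    unfolding circle_mean_def
    by (simp only: integral_diff[OF integrable_add[OF int(1,2)] int(3)] integral_add[OF int(1,2)])
  also have "(\<lambda>t. \<phi> t * ?K t + \<phi> t * cnj (?K t) - \<phi> t)
      = (\<lambda>t. of_real (poisson_kernel z t) * \<phi> t)"
  proof
    fix t
    have "?K t + cnj (?K t) - 1 = of_real (poisson_kernel z t)"
      unfolding complex_add_cnj poisson_kernel_def by simp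
    then show "\<phi> t * ?K t + \<phi> t * cnj (?K t) - \<phi> t = of_real (poisson_kernel z t) * \<phi> t"
      by (metis (no_types, lifting) mult.commute mult.right_neutral right_diff_distrib' ring_class.ring_distribs(1))
  qed
  finally show ?thesis .
qed

text \<open>The Poisson integral of the constant 1 is 1 + 1 - 1, because its Cauchy integral is
  1.\<close>

lemma integral_poisson_kernel:
  assumes z: "z \<in> unit_disc"
  shows "integral {0..2*pi} (poisson_kernel z) = 2*pi"
proof -
  have "circle_mean (\<lambda>t. of_real (poisson_kernel z t) :: complex) = 1"
    using poisson_mean_eq[of "\<lambda>_. 1", OF _ z] cauchy_mean_1[OF z]
    by (simp add: poisson_mean_def circle_mean_def)
  moreover have "integral {0..2*pi} (\<lambda>t. of_real (poisson_kernel z t) :: complex)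
      = of_real (integral {0..2*pi} (poisson_kernel z))"
    using continuous_on_poisson_kernel[OF z]
    by (intro integral_unique has_integral_of_real integrable_integral integrable_continuous_real)
  ultimately have "complex_of_real (integral {0..2*pi} (poisson_kernel z)) = of_real (2 * pi)"
    by (simp add: circle_mean_def scaleR_conv_of_real field_simps)
  then show ?thesis by (simp only: of_real_eq_iff)
qed

text \<open>Harnack's lower bound: the kernel is (1 - |z|^2) / |w|^2 with |w| \<le> 1 + |z|.\<close>

lemma poisson_kernel_ge:
  assumes z: "z \<in> unit_disc"
  shows "(1 - cmod z) / (1 + cmod z) \<le> poisson_kernel z t"
proof -
  define w where "w = 1 - z * cis (-t)"
  have w: "w \<noteq> 0" unfolding w_def by (rule cauchy_kernel_nz[OF z])
  have "cmod w \<le> 1 + cmod z"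
    unfolding w_def using norm_triangle_ineq4[of 1 "z * cis (-t)"] by (simp add: norm_mult)
  then have le: "(cmod w)\<^sup>2 \<le> (1 + cmod z)\<^sup>2" by (intro power_mono) auto
  \<comment> \<open>Expanding |1 - w|^2 = |z|^2 expresses 1 - |z|^2 through \<open>w\<close>.
    Dividing by |w|^2 then gives 2 Re (1/w) - 1, the kernel as defined.\<close>
  have "cmod (1 - w) = cmod z" by (simp add: w_def norm_mult)
  then have "(cmod z)\<^sup>2 = (1 - Re w)\<^sup>2 + (Im w)\<^sup>2"
    by (metis cmod_power2 minus_complex.simps one_complex.simps power2_minus diff_0)
  then have *: "1 - (cmod z)\<^sup>2 = 2 * Re w - (cmod w)\<^sup>2"
    unfolding cmod_power2[of w] by (simp add: power2_eq_square algebra_simps)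
  have z1: "cmod z < 1" using z by simp
  have "(1 - cmod z) / (1 + cmod z) = (1 - (cmod z)\<^sup>2) / (1 + cmod z)\<^sup>2"
  proof -
    have "1 + cmod z \<noteq> 0" by (smt (verit) norm_ge_zero)
    then show ?thesis by (simp add: divide_simps) (simp add: power2_eq_square algebra_simps)
  qed
  also have "\<dots> \<le> (1 - (cmod z)\<^sup>2) / (cmod w)\<^sup>2"
    using le w z1 by (intro divide_left_mono) (auto simp: abs_square_le_1 intro!: mult_pos_pos)
  also have "\<dots> = poisson_kernel z t"
    using w unfolding * poisson_kernel_def w_def[symmetric]
    by (simp add: diff_divide_distrib Re_divide cmod_power2) (simp add: complex_eq_iff)
  finally show ?thesis .
qed

text \<open>Subtracting the Harnack constant \<open>k\<close> from the kernel leaves a nonnegative kernel of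
  mass \<open>1 - k\<close>, and the part split off contributes \<open>k\<close> times the mean of \<open>\<phi>\<close>.\<close>

lemma norm_poisson_mean_less_1:
  assumes \<phi>: "continuous_on {0..2*pi} \<phi>" and z: "z \<in> unit_disc"
    and le: "\<And>t. cmod (\<phi> t) \<le> 1" and mean: "cmod (circle_mean \<phi>) < 1"
  shows "cmod (poisson_mean \<phi> z) < 1"
proof -
  define k where "k = (1 - cmod z) / (1 + cmod z)"
  have k: "k > 0" using z by (auto simp: k_def intro!: divide_pos_pos add_pos_nonneg)
  let ?P = "poisson_kernel z"
  note cont = \<phi> continuous_on_poisson_kernel[OF z, of "{0..2*pi}"]
  have "integral {0..2*pi} (\<lambda>t. of_real (?P t) * \<phi> t) =
      integral {0..2*pi} (\<lambda>t. of_real k * \<phi> t) + integral {0..2*pi} (\<lambda>t. of_real (?P t - k) * \<phi> t)"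
    using cont
    by (subst integral_add[symmetric])
      (auto intro!: integrable_continuous_real continuous_intros simp: algebra_simps)
  then have eq: "poisson_mean \<phi> z = of_real k * circle_mean \<phi>
      + integral {0..2*pi} (\<lambda>t. of_real (?P t - k) * \<phi> t) /\<^sub>R (2*pi)"
    by (simp add: poisson_mean_eq[OF \<phi> z] circle_mean_def scaleR_add_right)
  have "cmod (integral {0..2*pi} (\<lambda>t. of_real (?P t - k) * \<phi> t)) \<le> integral {0..2*pi} (\<lambda>t. ?P t - k)"
  proof (rule integral_norm_bound_integral)
    show "cmod (of_real (?P t - k) * \<phi> t) \<le> ?P t - k" for t
      using poisson_kernel_ge[OF z, of t] mult_left_mono[OF le[of t], of "?P t - k"]
      by (simp add: norm_mult k_def del: of_real_diff)
  qed (use cont in \<open>auto intro!: integrable_continuous_real continuous_intros\<close>)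
  also have "\<dots> = 2*pi * (1 - k)"
    using cont by (subst integral_diff)
      (auto intro!: integrable_continuous_real simp: integral_poisson_kernel[OF z] right_diff_distrib)
  finally have "cmod (integral {0..2*pi} (\<lambda>t. of_real (?P t - k) * \<phi> t) /\<^sub>R (2*pi)) \<le> 1 - k"
    by (simp add: field_simps)
  \<comment> \<open>The strict inequality enters here, from the mean of \<open>\<phi>\<close> lying
    inside the open disc and \<open>k > 0\<close>.\<close>
  moreover have "cmod (of_real k * circle_mean \<phi>) < k"
    using k mean by (simp add: norm_mult)
  ultimately show ?thesis unfolding eq
    using norm_triangle_ineq[of "of_real k * circle_mean \<phi>"
        "integral {0..2*pi} (\<lambda>t. of_real (?P t - k) * \<phi> t) /\<^sub>R (2*pi)"] by linarith
qed

section \<open>Trigonometric integrals and a symmetry\<close>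

lemma integral_cos_squared: "integral {0..2*pi} (\<lambda>t. (cos t)\<^sup>2) = pi"
proof -
  have "((\<lambda>t. (cos t)\<^sup>2) has_integral
      ((2*pi + sin (2*pi) * cos (2*pi)) / 2 - (0 + sin 0 * cos 0) / 2)) {0..2*pi}"
  proof (rule fundamental_theorem_of_calculus)
    fix t :: real
    have "1 + (cos t * cos t - sin t * sin t) = 2 * (cos t)\<^sup>2"
      using sin_cos_squared_add[of t] unfolding power2_eq_square by linarith
    then have "((\<lambda>t. (t + sin t * cos t) / 2) has_real_derivative (cos t)\<^sup>2) (at t within {0..2*pi})"
      by (auto intro!: derivative_eq_intros)
    then show "((\<lambda>t. (t + sin t * cos t) / 2) has_vector_derivative (cos t)\<^sup>2) (at t within {0..2*pi})"
      by (simp add: has_real_derivative_iff_has_vector_derivative)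
  qed simp
  then show ?thesis by (simp add: integral_unique)
qed

text \<open>The interval is cut at the zeros pi/2 and 3 pi/2, where cos changes sign. The value 4
  accounts for M(0) = 2 * 4 / (2 pi) = 4 / pi.\<close>

lemma integral_abs_cos: "integral {0..2*pi} (\<lambda>t. \<bar>cos t\<bar>) = 4"
proof -
  have pos: "((\<lambda>t. \<bar>cos t\<bar>) has_integral (sin b - sin a)) {a..b}"
    if ab: "a \<le> b" and nonneg: "\<And>t. t \<in> {a..b} \<Longrightarrow> 0 \<le> cos t" for a b :: real
  proof (rule fundamental_theorem_of_calculus[OF ab])
    fix t assume "t \<in> {a..b}"
    moreover have "(sin has_real_derivative cos t) (at t within {a..b})"
      by (auto intro!: derivative_eq_intros)
    ultimately show "(sin has_vector_derivative \<bar>cos t\<bar>) (at t within {a..b})"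
      using nonneg by (simp add: has_real_derivative_iff_has_vector_derivative)
  qed
  have neg: "((\<lambda>t. \<bar>cos t\<bar>) has_integral (- sin b - - sin a)) {a..b}"
    if ab: "a \<le> b" and nonpos: "\<And>t. t \<in> {a..b} \<Longrightarrow> cos t \<le> 0" for a b :: real
  proof (rule fundamental_theorem_of_calculus[OF ab])
    fix t assume "t \<in> {a..b}"
    moreover have "((\<lambda>t. - sin t) has_real_derivative - cos t) (at t within {a..b})"
      by (auto intro!: derivative_eq_intros)
    ultimately show "((\<lambda>t. - sin t) has_vector_derivative \<bar>cos t\<bar>) (at t within {a..b})"
      using nonpos by (simp add: has_real_derivative_iff_has_vector_derivative)
  qed
  have "((\<lambda>t. \<bar>cos t\<bar>) has_integral (sin (pi/2) - sin 0)) {0..pi/2}"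
    by (rule pos) (auto intro: cos_ge_zero)
  moreover have "((\<lambda>t. \<bar>cos t\<bar>) has_integral (- sin (3*pi/2) - - sin (pi/2))) {pi/2..3*pi/2}"
  proof (rule neg)
    fix t assume "t \<in> {pi/2..3*pi/2}"
    then have "0 \<le> cos (t - pi)" by (intro cos_ge_zero) auto
    then show "cos t \<le> 0" by simp
  qed simp
  moreover have "((\<lambda>t. \<bar>cos t\<bar>) has_integral (sin (2*pi) - sin (3*pi/2))) {3*pi/2..2*pi}"
  proof (rule pos)
    fix t assume "t \<in> {3*pi/2..2*pi}"
    then have "0 \<le> cos (t - 2*pi)" by (intro cos_ge_zero) auto
    then show "0 \<le> cos t" by (simp add: cos_diff)
  qed simp
  ultimately have "((\<lambda>t. \<bar>cos t\<bar>) has_integral ((sin (pi/2) - sin 0)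
      + (- sin (3*pi/2) - - sin (pi/2)) + (sin (2*pi) - sin (3*pi/2)))) {0..2*pi}"
    by (intro has_integral_combine[of 0 "3*pi/2" "2*pi"] has_integral_combine[of 0 "pi/2" "3*pi/2"]) auto
  moreover have "sin (3*pi/2) = -1" using sin_3over2_pi by simp
  ultimately show ?thesis by (simp add: integral_unique)
qed

text \<open>Shifting by pi maps the first half of the period onto the second and flips the sign, so
  the halves cancel.\<close>

lemma integral_antiperiodic:
  fixes g :: "real \<Rightarrow> real"
  assumes cont: "continuous_on {0..2*pi} g" and anti: "\<And>t. g (t + pi) = - g t"
  shows "integral {0..2*pi} g = 0"
proof -
  have "integral {0..pi} (g \<circ> (\<lambda>t. t + pi)) = integral {0 + pi..pi + pi} g"
    by (rule integral_shift) (rule continuous_on_subset[OF cont], auto)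
  moreover have "g \<circ> (\<lambda>t. t + pi) = (\<lambda>t. - g t)" using anti by auto
  moreover have "integral {0..pi} g + integral {pi..2*pi} g = integral {0..2*pi} g"
    by (rule Henstock_Kurzweil_Integration.integral_combine) (auto intro: integrable_continuous_real cont)
  ultimately show ?thesis by simp
qed

section \<open>Existence and uniqueness of \<lambda>(r), and positivity of M\<close>

text \<open>The function that \<open>lambda_fun\<close> inverts on (0,1).\<close>

definition lambda_mean :: "real \<Rightarrow> real" where
  "lambda_mean l = integral {0..2*pi} (\<lambda>t. l / sqrt (l\<^sup>2 + (cos t)\<^sup>2) / (2*pi))"

lemma radicand_pos: "l \<noteq> 0 \<Longrightarrow> 0 < l\<^sup>2 + (x::real)\<^sup>2"
  by (simp add: add_pos_nonneg)

lemma radicand_nz [simp]: "l \<noteq> 0 \<Longrightarrow> l\<^sup>2 + (x::real)\<^sup>2 \<noteq> 0"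
  using radicand_pos[of l x] by simp

lemma continuous_on_lambda_mean: "continuous_on {0<..} lambda_mean"
  unfolding lambda_mean_def[abs_def] cbox_interval[symmetric]
  by (rule integral_continuous_on_param) (auto intro!: continuous_intros simp: split_beta)

text \<open>Follows from cos^2 \<le> 1 in the integrand. It provides an explicit point where
  \<open>lambda_mean\<close> is at least a given r < 1.\<close>

lemma lambda_mean_ge:
  assumes "0 < l"
  shows "l / sqrt (l\<^sup>2 + 1) \<le> lambda_mean l"
proof -
  have "integral {0..2*pi} (\<lambda>t. l / sqrt (l\<^sup>2 + 1) / (2*pi)) \<le> lambda_mean l"
    unfolding lambda_mean_def
  proof (rule integral_le)
    show "l / sqrt (l\<^sup>2 + 1) / (2*pi) \<le> l / sqrt (l\<^sup>2 + (cos t)\<^sup>2) / (2*pi)" for t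
      using assms radicand_pos[of l "cos t"] radicand_pos[of l 1]
      by (intro divide_right_mono divide_left_mono) (auto simp: abs_square_le_1 intro!: mult_pos_pos)
  qed (use assms in \<open>auto intro!: integrable_continuous_real continuous_intros\<close>)
  then show ?thesis by simp
qed

text \<open>Dominated convergence along l = 1/(n+1): the integrands are bounded by 1 and tend to 0
  wherever cos t is nonzero.\<close>

lemma tendsto_lambda_mean_0: "(\<lambda>n. lambda_mean (inverse (real (Suc n)))) \<longlonglongrightarrow> 0"
proof -
  define f where "f n t = inverse (real (Suc n)) /
    sqrt ((inverse (real (Suc n)))\<^sup>2 + (cos t)\<^sup>2) / (2*pi)" for n t
  \<comment> \<open>The pointwise limit. At a zero of cos the integrand equals 1 / (2 pi) for every
    \<open>n\<close>, so the limit vanishes only off the finite set {pi/2, 3 pi/2}.\<close>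
  define g where "g t = (if cos t = 0 then 1 / (2*pi) else 0)" for t :: real
  have le: "norm (f n t) \<le> 1" for n t
  proof -
    define q where "q = inverse (real (Suc n)) / sqrt ((inverse (real (Suc n)))\<^sup>2 + (cos t)\<^sup>2)"
    have "inverse (real (Suc n)) \<le> sqrt ((inverse (real (Suc n)))\<^sup>2 + (cos t)\<^sup>2)"
      by (rule real_le_rsqrt) simp
    moreover have "0 < inverse (real (Suc n))" by simp
    ultimately have "0 \<le> q" "q \<le> 1"
      unfolding q_def by (auto simp only: divide_le_eq_1 intro!: divide_nonneg_nonneg)
    moreover have "1 \<le> 2*pi" using pi_gt3 by simp
    ultimately have "\<bar>q / (2*pi)\<bar> \<le> 1" by (simp add: divide_le_eq)
    then show ?thesis by (simp only: f_def q_def real_norm_def)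
  qed
  have lim: "(\<lambda>n. f n t) \<longlonglongrightarrow> g t" for t
  proof (cases "cos t = 0")
    case True
    then show ?thesis by (simp add: f_def g_def)
  next
    case False
    have "(\<lambda>n. f n t) \<longlonglongrightarrow> 0 / sqrt (0\<^sup>2 + (cos t)\<^sup>2) / (2*pi)"
      unfolding f_def using False
      by (intro tendsto_intros LIMSEQ_inverse_real_of_nat) auto
    then show ?thesis using False by (simp add: g_def)
  qed
  have "(\<lambda>n. integral {0..2*pi} (f n)) \<longlonglongrightarrow> integral {0..2*pi} g"
  proof (rule dominated_convergence(2))
    show "f n integrable_on {0..2*pi}" for n
      unfolding f_def by (auto intro!: integrable_continuous_real continuous_intros)
    show "(\<lambda>_. 1::real) integrable_on {0..2*pi}"
      by (intro integrable_continuous_real continuous_on_const)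
  qed (use le lim in auto)
  moreover have "integral {0..2*pi} g = 0"
  proof -
    have "(g has_integral 0) {0..2*pi}"
    proof (rule has_integral_spike_finite[OF _ _ has_integral_0])
      show "finite {pi/2, 3*pi/2}" by simp
      fix t assume t: "t \<in> {0..2*pi} - {pi/2, 3*pi/2}"
      have "cos t \<noteq> 0"
      proof
        assume c: "cos t = 0"
        show False
        proof (cases "t \<le> pi")
          case True
          have "t = pi/2" by (rule cos_inj_pi) (use True t c in simp_all)
          then show ?thesis using t by simp
        next
          case False
          have "t - pi = pi/2" by (rule cos_inj_pi) (use False t c in simp_all)
          then have "t = 3*pi/2" by linarith
          then show ?thesis using t by simp
        qed
      qed
      then show "g t = 0" by (simp add: g_def)
    qed
    then show ?thesis by (rule integral_unique)
  qed
  ultimately show ?thesis by (simp add: f_def[abs_def] lambda_mean_def)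
qed

text \<open>The integrand is nondecreasing in \<open>l\<close> for every t, and strictly increasing
  at t = 0, where cos t = 1. A continuous nonnegative difference that is positive at one point has
  nonzero integral.\<close>

lemma lambda_mean_strict_mono:
  assumes "0 < l" "l < m"
  shows "lambda_mean l < lambda_mean m"
proof -
  define d where "d t = m / sqrt (m\<^sup>2 + (cos t)\<^sup>2) / (2*pi) - l / sqrt (l\<^sup>2 + (cos t)\<^sup>2) / (2*pi)" for t
  have cont: "continuous_on {0..2*pi} (\<lambda>t. x / sqrt (x\<^sup>2 + (cos t)\<^sup>2) / (2*pi))" if "x > 0" for x :: real
    using that by (auto intro!: continuous_intros)
  have eq: "lambda_mean m - lambda_mean l = integral {0..2*pi} d"
    unfolding d_def lambda_mean_def using assms
    by (intro integral_diff[symmetric] integrable_continuous_real cont) auto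
  have cmp: "l * sqrt (m\<^sup>2 + c\<^sup>2) \<le> m * sqrt (l\<^sup>2 + c\<^sup>2)" for c
  proof -
    have "sqrt (l\<^sup>2 * (m\<^sup>2 + c\<^sup>2)) \<le> sqrt (m\<^sup>2 * (l\<^sup>2 + c\<^sup>2))"
      using assms mult_right_mono[of "l\<^sup>2" "m\<^sup>2" "c\<^sup>2"]
      by (simp add: power_mono algebra_simps)
    then show ?thesis using assms by (simp add: real_sqrt_mult)
  qed
  have nonneg: "0 \<le> d t" for t
    using cmp[of "cos t"] assms radicand_pos[of m "cos t"] radicand_pos[of l "cos t"]
    by (simp add: d_def divide_simps)
  have "0 < d 0"
  proof -
    have "sqrt (l\<^sup>2 * (m\<^sup>2 + 1)) < sqrt (m\<^sup>2 * (l\<^sup>2 + 1))"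
      using assms by (simp add: power_strict_mono algebra_simps)
    then have "l * sqrt (m\<^sup>2 + 1) < m * sqrt (l\<^sup>2 + 1)" using assms by (simp add: real_sqrt_mult)
    then show ?thesis using assms radicand_pos[of m 1] radicand_pos[of l 1]
      by (simp add: d_def divide_simps)
  qed
  moreover have "continuous_on {0..2*pi} d"
    unfolding d_def using assms by (intro continuous_intros cont) auto
  ultimately have "integral {0..2*pi} d \<noteq> 0"
    using integral_eq_0_iff[of 0 "2*pi" d] nonneg by fastforce
  moreover have "0 \<le> integral {0..2*pi} d"
    using nonneg by (intro integral_nonneg integrable_continuous_real \<open>continuous_on {0..2*pi} d\<close>)
  ultimately show ?thesis using eq by linarith
qed

text \<open>The intermediate value theorem gives a solution and strict monotonicity its uniqueness,
  so the definite description is well defined.\<close>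

lemma lambda_fun:
  assumes r: "0 < r" "r < 1"
  shows "0 < lambda_fun r" "lambda_mean (lambda_fun r) = r"
proof -
  obtain n where n: "lambda_mean (inverse (real (Suc n))) < r"
    using order_tendstoD(2)[OF tendsto_lambda_mean_0 r(1)] eventually_sequentially by force
  define a where "a = inverse (real (Suc n))"
  have a: "0 < a" "lambda_mean a < r" using n by (simp_all add: a_def)
  \<comment> \<open>\<open>b\<close> solves b / sqrt (b^2 + 1) = r, so the lower bound for
    \<open>lambda_mean\<close> gives at least \<open>r\<close> there.\<close>
  define b where "b = r / sqrt (1 - r\<^sup>2)"
  have r2: "0 < 1 - r\<^sup>2" using r by (simp add: abs_square_less_1)
  have b: "0 < b" using r r2 by (simp add: b_def)
  have "b\<^sup>2 = r\<^sup>2 / (1 - r\<^sup>2)" using r2 by (simp add: b_def power_divide)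
  then have "b\<^sup>2 + 1 = 1 / (1 - r\<^sup>2)" using r2 by (simp add: field_simps)
  then have "sqrt (b\<^sup>2 + 1) = 1 / sqrt (1 - r\<^sup>2)" by (simp add: real_sqrt_divide)
  then have "b / sqrt (b\<^sup>2 + 1) = b * sqrt (1 - r\<^sup>2)" by simp
  also have "\<dots> = r" using r2 by (simp add: b_def)
  finally have "b / sqrt (b\<^sup>2 + 1) = r" .
  then have rb: "r \<le> lambda_mean b" using lambda_mean_ge[OF b] by simp
  have "a \<le> b"
    using a(2) b rb lambda_mean_strict_mono[of b a] by linarith
  moreover have "continuous_on {a..b} lambda_mean"
    by (rule continuous_on_subset[OF continuous_on_lambda_mean]) (use a in auto)
  ultimately obtain l where l: "a \<le> l" "lambda_mean l = r"
    using IVT'[of lambda_mean a r b] a rb by auto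
  have l0: "0 < l" using l(1) a(1) by simp
  have "0 < lambda_fun r \<and> r = lambda_mean (lambda_fun r)"
    unfolding lambda_fun_def lambda_mean_def[symmetric]
  proof (rule theI)
    show "0 < l \<and> r = lambda_mean l" using l(2) l0 by simp
    show "m = l" if "0 < m \<and> r = lambda_mean m" for m
      using that l(2) l0 lambda_mean_strict_mono[of m l] lambda_mean_strict_mono[of l m]
      by (metis less_irrefl linorder_neqE)
  qed
  then show "0 < lambda_fun r" "lambda_mean (lambda_fun r) = r" by auto
qed

text \<open>For r > 0, replacing cos^2 by 1 under the root bounds the integral below by a positive
  multiple of the integral of cos^2.\<close>

lemma M_fun_pos:
  assumes "0 \<le> r" "r < 1"
  shows "0 < M_fun r"
proof (cases "r = 0")
  case True
  then show ?thesis by (simp add: M_fun_def)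
next
  case False
  define l where "l = lambda_fun r"
  have l: "0 < l" using lambda_fun[of r] assms False by (simp add: l_def)
  have "integral {0..2*pi} (\<lambda>t. (cos t)\<^sup>2 / (sqrt (l\<^sup>2 + 1) * (2*pi)))
      \<le> integral {0..2*pi} (\<lambda>t. (cos t)\<^sup>2 / sqrt (l\<^sup>2 + (cos t)\<^sup>2) / (2*pi))"
  proof (rule integral_le)
    show "(cos t)\<^sup>2 / (sqrt (l\<^sup>2 + 1) * (2*pi)) \<le> (cos t)\<^sup>2 / sqrt (l\<^sup>2 + (cos t)\<^sup>2) / (2*pi)" for t
      unfolding divide_divide_eq_left[symmetric]
      using l radicand_pos[of l "cos t"] radicand_pos[of l 1]
      by (intro divide_right_mono divide_left_mono) (auto simp: abs_square_le_1 intro!: mult_pos_pos)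
  qed (use l radicand_nz[of l 1] in \<open>auto intro!: integrable_continuous_real continuous_intros\<close>)
  moreover have "0 < pi / (sqrt (l\<^sup>2 + 1) * (2*pi))"
    using radicand_pos[of l 1] l by (auto intro!: divide_pos_pos mult_pos_pos)
  moreover have "integral {0..2*pi} (\<lambda>t. (cos t)\<^sup>2 / (sqrt (l\<^sup>2 + 1) * (2*pi)))
      = pi / (sqrt (l\<^sup>2 + 1) * (2*pi))"
    by (simp only: integral_divide integral_cos_squared)
  ultimately have "0 < integral {0..2*pi} (\<lambda>t. (cos t)\<^sup>2 / sqrt (l\<^sup>2 + (cos t)\<^sup>2) / (2*pi))"
    by linarith
  then show ?thesis
    using False unfolding M_fun_def l_def[symmetric] by simp
qed

section \<open>Harmonic self-maps of the disc with large derivative at 0\<close>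

lemma exists_harmonic_map:
  assumes contphi: "continuous_on {0..2*pi} \<phi>" and le: "\<And>t. cmod (\<phi> t) \<le> 1"
    and mean: "cmod (circle_mean \<phi>) < 1"
  obtains f D where "harmonic_on f unit_disc" "\<forall>z\<in>unit_disc. f z \<in> unit_disc"
    "f 0 = circle_mean \<phi>" "(f has_derivative D) (at 0)"
    "D 1 = 2 * circle_mean (\<lambda>t. \<phi> t * of_real (cos t))"
proof -
  obtain D where "(poisson_mean \<phi> has_derivative D) (at 0)"
    "D 1 = 2 * circle_mean (\<lambda>t. \<phi> t * of_real (cos t))"
    using has_derivative_poisson_mean_0[OF contphi] by blast
  then show ?thesis
    using that[of "poisson_mean \<phi>" D] harmonic_on_poisson_mean[OF contphi] poisson_mean_0
      norm_poisson_mean_less_1[OF contphi _ le mean] by auto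
qed

lemma circle_mean_Complex:
  assumes "continuous_on {0..2*pi} x" "continuous_on {0..2*pi} y"
  shows "circle_mean (\<lambda>t. Complex (x t) (y t)) = Complex (circle_mean x) (circle_mean y)"
proof -
  have int: "(\<lambda>t. complex_of_real (x t)) integrable_on {0..2*pi}"
      "(\<lambda>t. \<i> * complex_of_real (y t)) integrable_on {0..2*pi}"
    using assms by (auto intro!: integrable_continuous_real continuous_intros)
  have of_real: "integral {0..2*pi} (\<lambda>t. complex_of_real (g t)) = of_real (integral {0..2*pi} g)"
    if "continuous_on {0..2*pi} g" for g
    using that
    by (intro integral_unique has_integral_of_real integrable_integral integrable_continuous_real)
  show ?thesis
    unfolding circle_mean_def Complex_eq integral_add[OF int] integral_mult_right
      of_real[OF assms(1)] of_real[OF assms(2)]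
    by (simp add: scaleR_conv_of_real ring_distribs mult.left_commute)
qed

text \<open>The boundary values \<open>(x + \<i> cos) / sqrt (l\<^sup>2 + cos\<^sup>2)\<close> with \<open>x = l\<close> give the
  extremal map for \<open>r > 0\<close>. The values with \<open>x = 0\<close> are continuous approximations of the
  discontinuous extremal \<open>\<i> sgn (cos t)\<close> for \<open>r = 0\<close>.\<close>

lemma exists_harmonic_map_extremal:
  fixes x l :: real
  assumes l: "0 < l" and x: "\<bar>x\<bar> \<le> l"
    and mean: "\<bar>circle_mean (\<lambda>t. x / sqrt (l\<^sup>2 + (cos t)\<^sup>2))\<bar> < 1"
  obtains f D where "harmonic_on f unit_disc" "\<forall>z\<in>unit_disc. f z \<in> unit_disc"
    "f 0 = of_real (circle_mean (\<lambda>t. x / sqrt (l\<^sup>2 + (cos t)\<^sup>2)))"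
    "(f has_derivative D) (at 0)"
    "cmod (D 1) = \<bar>2 * circle_mean (\<lambda>t. (cos t)\<^sup>2 / sqrt (l\<^sup>2 + (cos t)\<^sup>2))\<bar>"
proof -
  define s where "s t = sqrt (l\<^sup>2 + (cos t)\<^sup>2)" for t
  have s: "s t > 0" for t using radicand_pos[of l "cos t"] l by (simp add: s_def)
  have s0: "s t \<noteq> 0" for t using s[of t] by simp
  have s2: "(s t)\<^sup>2 = l\<^sup>2 + (cos t)\<^sup>2" for t by (simp add: s_def)
  have cont: "continuous_on {0..2*pi} s" unfolding s_def by (intro continuous_intros)
  have s_pi: "s (t + pi) = s t" for t by (simp add: s_def)
  define \<phi> where "\<phi> t = Complex (x / s t) (cos t / s t)" for t
  have cont_\<phi>: "continuous_on {0..2*pi} \<phi>"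
    unfolding \<phi>_def Complex_eq using s0 cont by (intro continuous_intros) auto
  have le: "cmod (\<phi> t) \<le> 1" for t
  proof -
    have "(cmod (\<phi> t))\<^sup>2 = (x\<^sup>2 + (cos t)\<^sup>2) / (s t)\<^sup>2"
      by (simp add: cmod_power2 \<phi>_def power_divide add_divide_distrib)
    also have "\<dots> \<le> 1"
      unfolding s2 using abs_le_square_iff[of x l] x l radicand_pos[of l "cos t"] by simp
    finally show ?thesis by (simp add: abs_square_le_1)
  qed
  have mean_\<phi>: "circle_mean \<phi> = of_real (circle_mean (\<lambda>t. x / s t))"
  proof -
    \<comment> \<open>Under t \<mapsto> t + pi the root \<open>s\<close> is unchanged and cos
      changes sign, so the imaginary part of the mean vanishes.\<close>
    have "integral {0..2*pi} (\<lambda>t. cos t / s t) = 0"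
      by (rule integral_antiperiodic) (use cont s0 in \<open>auto intro!: continuous_intros simp: s_pi\<close>)
    then have "circle_mean (\<lambda>t. cos t / s t) = 0" by (simp add: circle_mean_def)
    moreover have "circle_mean \<phi> = Complex (circle_mean (\<lambda>t. x / s t)) (circle_mean (\<lambda>t. cos t / s t))"
      unfolding \<phi>_def
      by (rule circle_mean_Complex) (use cont s0 in \<open>auto intro!: continuous_intros\<close>)
    ultimately show ?thesis by (simp add: complex_eq_iff)
  qed
  have less: "cmod (circle_mean \<phi>) < 1"
    using mean by (simp add: mean_\<phi> s_def)
  \<comment> \<open>The same antisymmetry removes the real part of the mean of \<open>\<phi>\<close>
    times cos. What remains is \<i> times a real number.\<close>
  have D: "cmod (2 * circle_mean (\<lambda>t. \<phi> t * of_real (cos t)))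
      = \<bar>2 * circle_mean (\<lambda>t. (cos t)\<^sup>2 / s t)\<bar>"
  proof -
    have "integral {0..2*pi} (\<lambda>t. x / s t * cos t) = 0"
      by (rule integral_antiperiodic) (use cont s0 in \<open>auto intro!: continuous_intros simp: s_pi\<close>)
    then have "circle_mean (\<lambda>t. x / s t * cos t) = 0" by (simp add: circle_mean_def)
    moreover have "(\<lambda>t. \<phi> t * of_real (cos t)) = (\<lambda>t. Complex (x / s t * cos t) ((cos t)\<^sup>2 / s t))"
      by (auto simp: \<phi>_def complex_eq_iff power2_eq_square)
    moreover have "circle_mean (\<lambda>t. Complex (x / s t * cos t) ((cos t)\<^sup>2 / s t))
        = Complex (circle_mean (\<lambda>t. x / s t * cos t)) (circle_mean (\<lambda>t. (cos t)\<^sup>2 / s t))"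
      by (rule circle_mean_Complex) (use cont s0 in \<open>auto intro!: continuous_intros\<close>)
    ultimately show ?thesis by (simp add: norm_mult abs_mult complex_norm)
  qed
  obtain f D where "harmonic_on f unit_disc" "\<forall>z\<in>unit_disc. f z \<in> unit_disc"
    "f 0 = circle_mean \<phi>" "(f has_derivative D) (at 0)"
    "D 1 = 2 * circle_mean (\<lambda>t. \<phi> t * of_real (cos t))"
    by (rule exists_harmonic_map[OF cont_\<phi> le less])
  then show ?thesis
    using that[of f D] D unfolding mean_\<phi> s_def by simp
qed

lemma circle_mean_eq_integral:
  fixes g :: "real \<Rightarrow> real"
  shows "circle_mean g = integral {0..2*pi} (\<lambda>t. g t / (2*pi))"
  by (simp only: circle_mean_def integral_divide) (simp only: divide_inverse_commute real_scaleR_def)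

text \<open>For r > 0 the choice x = l = \<lambda>(r) gives exactly M(r). The loss \<open>e\<close>
  serves r = 0, where the discontinuous extremal boundary values are replaced by continuous
  ones.\<close>

lemma exists_harmonic_map_near_M_fun:
  assumes r: "0 \<le> r" "r < 1" and e: "0 < e"
  obtains f D where "harmonic_on f unit_disc" "\<forall>z\<in>unit_disc. f z \<in> unit_disc"
    "f 0 = of_real r" "(f has_derivative D) (at 0)" "M_fun r - e \<le> cmod (D 1)"
proof (cases "r = 0")
  case False
  define l where "l = lambda_fun r"
  have l: "0 < l" and mean: "circle_mean (\<lambda>t. l / sqrt (l\<^sup>2 + (cos t)\<^sup>2)) = r"
    using lambda_fun[of r] r False by (simp_all add: l_def circle_mean_eq_integral lambda_mean_def)
  obtain f D where "harmonic_on f unit_disc" "\<forall>z\<in>unit_disc. f z \<in> unit_disc"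
    "f 0 = of_real r" "(f has_derivative D) (at 0)"
    "cmod (D 1) = \<bar>2 * circle_mean (\<lambda>t. (cos t)\<^sup>2 / sqrt (l\<^sup>2 + (cos t)\<^sup>2))\<bar>"
    using exists_harmonic_map_extremal[of l l] l r unfolding mean by auto
  moreover have "M_fun r = 2 * circle_mean (\<lambda>t. (cos t)\<^sup>2 / sqrt (l\<^sup>2 + (cos t)\<^sup>2))"
    using False by (simp add: M_fun_def circle_mean_eq_integral l_def)
  ultimately show ?thesis using that e by fastforce
next
  case True
  \<comment> \<open>The estimate below loses 2 pi l in the integral, which is 2 l = \<open>e\<close>
    after the factor 2 / (2 pi).\<close>
  define l where "l = e / 2"
  have l: "0 < l" using e by (simp add: l_def)
  obtain f D where f: "harmonic_on f unit_disc" "\<forall>z\<in>unit_disc. f z \<in> unit_disc"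
    "f 0 = of_real 0" "(f has_derivative D) (at 0)"
    and D: "cmod (D 1) = \<bar>2 * circle_mean (\<lambda>t. (cos t)\<^sup>2 / sqrt (l\<^sup>2 + (cos t)\<^sup>2))\<bar>"
    using exists_harmonic_map_extremal[of l 0] l by (auto simp: circle_mean_def)
  have "integral {0..2*pi} (\<lambda>t. \<bar>cos t\<bar> - l) \<le> integral {0..2*pi} (\<lambda>t. (cos t)\<^sup>2 / sqrt (l\<^sup>2 + (cos t)\<^sup>2))"
  proof (rule integral_le)
    fix t
    have "sqrt (l\<^sup>2 + (cos t)\<^sup>2) \<le> l + \<bar>cos t\<bar>"
      using l sqrt_sum_squares_le_sum[of l "\<bar>cos t\<bar>"] by simp
    \<comment> \<open>With c = |cos t|, the bound sqrt (l^2 + c^2) \<le> l + c reduces this to (c -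
      l) (c + l) \<le> c^2. Multiplying that bound by c - l needs a nonnegative factor; otherwise
      the left side is already nonpositive.\<close>
    then have "(\<bar>cos t\<bar> - l) * sqrt (l\<^sup>2 + (cos t)\<^sup>2) \<le> (cos t)\<^sup>2"
    proof (cases "\<bar>cos t\<bar> \<le> l")
      case True
      then have "(\<bar>cos t\<bar> - l) * sqrt (l\<^sup>2 + (cos t)\<^sup>2) \<le> 0"
        by (intro mult_nonpos_nonneg) auto
      then show ?thesis by (rule order_trans) simp
    next
      case False
      then have "(\<bar>cos t\<bar> - l) * sqrt (l\<^sup>2 + (cos t)\<^sup>2) \<le> (\<bar>cos t\<bar> - l) * (l + \<bar>cos t\<bar>)"
        using \<open>sqrt (l\<^sup>2 + (cos t)\<^sup>2) \<le> l + \<bar>cos t\<bar>\<close> by (intro mult_left_mono) auto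
      also have "\<dots> = (cos t)\<^sup>2 - l\<^sup>2"
        by (simp add: algebra_simps power2_eq_square)
      finally show ?thesis using zero_le_power2[of l] by linarith
    qed
    then show "\<bar>cos t\<bar> - l \<le> (cos t)\<^sup>2 / sqrt (l\<^sup>2 + (cos t)\<^sup>2)"
      using l radicand_pos[of l "cos t"] by (simp add: pos_le_divide_eq)
  qed (use l in \<open>auto intro!: integrable_continuous_real continuous_intros\<close>)
  moreover have "integral {0..2*pi} (\<lambda>t. \<bar>cos t\<bar> - l) = 4 - 2*pi*l"
    by (subst integral_diff)
      (auto intro!: integrable_continuous_real continuous_intros simp: integral_abs_cos)
  ultimately have "2 * ((4 - 2*pi*l) / (2*pi)) \<le> 2 * circle_mean (\<lambda>t. (cos t)\<^sup>2 / sqrt (l\<^sup>2 + (cos t)\<^sup>2))"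
    unfolding circle_mean_eq_integral integral_divide
    by (intro mult_left_mono divide_right_mono) auto
  moreover have "2 * ((4 - 2*pi*l) / (2*pi)) = 4 / pi - e"
    by (simp add: l_def field_simps)
  ultimately have "M_fun r - e \<le> cmod (D 1)"
    using True D by (simp add: M_fun_def)
  then show ?thesis using that f True by metis
qed

section \<open>Comparison of the weights through maps varying in one coordinate\<close>

lemma harmonic_on_const: "open S \<Longrightarrow> harmonic_on (\<lambda>z. c) S"
  by (intro harmonic_on_holomorphic holomorphic_on_const)

theorem proposition11p7:
  fixes a :: "'n::finite \<Rightarrow> complex ^ 'n \<Rightarrow> real"
  assumes a_pos: "\<And>j p. p \<in> polydisc \<Longrightarrow> 0 < a j p"
    and contract: "\<And>F :: complex \<Rightarrow> complex ^ 'n.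
      harmonic_map_on F unit_disc \<Longrightarrow> (\<forall>z\<in>unit_disc. F z \<in> polydisc) \<Longrightarrow>
      (\<forall>z\<in>unit_disc. \<forall>\<xi>. weighted_max a (F z) (frechet_derivative F (at z) \<xi>)
                             \<le> 2 * cmod \<xi> / (1 - (cmod z)\<^sup>2))"
  shows "\<forall>p\<in>polydisc. \<forall>v. weighted_max a p v \<le> H_polydisc p v"
proof (intro ballI allI)
  fix p :: "complex ^ 'n" and v :: "complex ^ 'n"
  assume p: "p \<in> polydisc"
  \<comment> \<open>Both sides of the claim are maxima of multiples of |v_j|, so comparing
    coefficients for each \<open>j\<close> suffices.\<close>
  have bound: "a j p \<le> 2 / M_fun (cmod (p $ j))" for j
  proof -
    define r where "r = cmod (p $ j)"
    have r: "0 \<le> r" "r < 1" using p by (auto simp: r_def polydisc_def)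
    have "a j p * M_fun r \<le> 2 + d" if d: "0 < d" for d
    proof -
      have ap: "0 < a j p" by (rule a_pos[OF p])
      \<comment> \<open>Scaled so that the loss \<open>e\<close> in the derivative costs exactly
        \<open>d\<close> after multiplication by the weight.\<close>
      define e where "e = d / a j p"
      have e: "0 < e" using d ap by (simp add: e_def)
      obtain f D where f: "harmonic_on f unit_disc" "\<forall>z\<in>unit_disc. f z \<in> unit_disc"
        "f 0 = of_real r" "(f has_derivative D) (at 0)" "M_fun r - e \<le> cmod (D 1)"
        by (rule exists_harmonic_map_near_M_fun[OF r e])
      \<comment> \<open>The rotation taking \<open>r\<close> to the j-th coordinate of
        \<open>p\<close>. For r = 0 any unimodular constant works, whereas the quotient would be
        0.\<close>
      define c where "c = (if r = 0 then 1 else p $ j / of_real r)"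
      have c: "cmod c = 1" "c * of_real r = p $ j"
        by (auto simp: c_def r_def norm_divide)
      define F where "F z = (\<chi> i. if i = j then c * f z else p $ i)" for z
      have "harmonic_map_on F unit_disc"
        unfolding harmonic_map_on_def
      proof
        fix i show "harmonic_on (\<lambda>z. F z $ i) unit_disc"
          using harmonic_on_bounded_linear[OF bounded_linear_mult_right[of c] f(1)]
          by (cases "i = j") (simp_all add: F_def harmonic_on_const)
      qed
      moreover have "\<forall>z\<in>unit_disc. F z \<in> polydisc"
        using f(2) p by (auto simp: F_def polydisc_def norm_mult c(1))
      ultimately have "\<forall>z\<in>unit_disc. \<forall>\<xi>. weighted_max a (F z) (frechet_derivative F (at z) \<xi>)
                             \<le> 2 * cmod \<xi> / (1 - (cmod z)\<^sup>2)"
        by (rule contract)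
      then have "weighted_max a (F 0) (frechet_derivative F (at 0) 1) \<le> 2 * cmod 1 / (1 - (cmod 0)\<^sup>2)"
        by (meson centre_in_ball zero_less_one)
      moreover have "F 0 = p"
        using c(2) by (auto simp: F_def vec_eq_iff f(3))
      \<comment> \<open>\<open>F\<close> is \<open>axis j\<close> applied to \<open>c * f z\<close>
        plus a constant vector, so its differential lies along the j-th coordinate. The weighted
        maximum of this differential then bounds the j-th weight alone.\<close>
      moreover have "(F has_derivative (\<lambda>v. axis j (c * D v))) (at 0)"
      proof -
        have bl: "bounded_linear (axis j :: complex \<Rightarrow> complex ^ 'n)"
          by (rule linear_conv_bounded_linear[THEN iffD1])
            (auto intro!: linearI simp: axis_def vec_eq_iff)
        have "((\<lambda>z. axis j (c * f z) + (\<chi> i. if i = j then 0 else p $ i)) has_derivative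
            (\<lambda>v. axis j (c * D v) + 0)) (at 0)"
          by (intro has_derivative_add has_derivative_const bounded_linear.has_derivative[OF bl]
              bounded_linear.has_derivative[OF bounded_linear_mult_right] f(4))
        moreover have "(\<lambda>z. axis j (c * f z) + (\<chi> i. if i = j then 0 else p $ i)) = F"
          by (auto simp: F_def axis_def vec_eq_iff)
        ultimately show ?thesis by simp
      qed
      then have "frechet_derivative F (at 0) = (\<lambda>v. axis j (c * D v))"
        by (rule frechet_derivative_at[symmetric])
      ultimately have "weighted_max a p (axis j (c * D 1)) \<le> 2" by simp
      moreover have "a j p * cmod (axis j (c * D 1) $ j) \<le> weighted_max a p (axis j (c * D 1))"
        unfolding weighted_max_def by (intro Max_ge finite_imageI finite rangeI)
      ultimately have "a j p * cmod (D 1) \<le> 2" by (simp add: axis_def norm_mult c(1))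
      moreover have "a j p * (M_fun r - e) \<le> a j p * cmod (D 1)"
        using ap f(5) by (intro mult_left_mono) auto
      moreover have "a j p * e = d" using ap by (simp add: e_def)
      ultimately show ?thesis by (simp add: right_diff_distrib)
    qed
    then have "a j p * M_fun r \<le> 2" by (rule field_le_epsilon)
    then show ?thesis
      using M_fun_pos[OF r] by (simp add: pos_le_divide_eq flip: r_def)
  qed
  show "weighted_max a p v \<le> H_polydisc p v"
    unfolding weighted_max_def
  proof (rule Max.boundedI)
    fix y assume "y \<in> range (\<lambda>j. a j p * cmod (v $ j))"
    then obtain j where y: "y = a j p * cmod (v $ j)" by auto
    have "y \<le> 2 * cmod (v $ j) / M_fun (cmod (p $ j))"
      using mult_right_mono[OF bound[of j], of "cmod (v $ j)"] by (simp add: y)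
    also have "\<dots> \<le> H_polydisc p v"
      unfolding H_polydisc_def by (rule Max_ge) auto
    finally show "y \<le> H_polydisc p v" .
  qed auto
qed

end
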